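(* Let $k\ge 3$ be an integer, written as $k=2m$ with $m\ge 2$ if $k$ is even and $k=2m+1$ with $m\ge 1$ if $k$ is odd. Let $p$ be a prime such that $p>m^2$ if $k=2m$, and $p>\frac{2m^3+5m^2-8m-3}{2(m+1)}$ if $k=2m+1$. Let $r\in\{0,1,\dots,k-1\}$ with $p\equiv r \pmod k$. (i) If $k$ is even and $r\in\{1,m+1,m+2,\dots,k-1\}$, then $g^k(C_p)=\frac{p-1}{k}+k$ if $r=1$, and $g^k(C_p)=\frac{p-r}{k}+k+1$ if $r\neq 1$. (ii) If $k$ is odd and $r\in\{1,\dots,k-1\}$, then $g^k(C_p)=\frac{p-1}{k}+k$ if $r=1$, and $\frac{p-r}{k}+k\le g^k(C_p)\le \frac{p-r}{k}+k+1$ if $r\neq 1$.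
   Context: $C_p$ denotes the cyclic group of order $p$. For a finite abelian group $G$ (written additively) and a positive integer $k$, the $k$-Harborth constant $g^k(G)$ is the smallest positive integer $t$ such that every subset $S\subseteq G$ with $|S|\ge t$ contains a subset $T$ with $|T|=k$ and $\sum_{x\in T}x=0$.
   Formalization: The single pair k=5, p=3 is excluded: there 3 > 17/6 and r=3, so part (ii) would claim 5 ≤ g^5(C_3) ≤ 6, but C_3 has only 3 elements and so g^5(C_3)=4. *)

theory Defs
  imports
    Complex_Main
    "HOL-Algebra.FiniteProduct"
    "HOL-Algebra.Elementary_Groups"
    "HOL-Number_Theory.Cong"
    "HOL-Computational_Algebra.Primes"
begin

text \<open>Groups of HOL-Algebra are written multiplicatively, so the sum of the elements of \<open>T\<close>
  is \<open>finprod\<close> and zero is \<open>\<one>\<close>. For finite \<open>G\<close> the least element exists, since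
  \<open>t = card (carrier G) + 1\<close> satisfies the condition vacuously.\<close>

definition k_harborth :: "nat \<Rightarrow> ('a, 'b) monoid_scheme \<Rightarrow> nat" where
  "k_harborth k G =
     (LEAST t. 0 < t \<and>
        (\<forall>S. S \<subseteq> carrier G \<and> t \<le> card S \<longrightarrow>
           (\<exists>T. T \<subseteq> S \<and> card T = k \<and> finprod G (\<lambda>x. x) T = \<one>\<^bsub>G\<^esub>)))"

text \<open>A cyclic group of order 3 has no subset of size 5, so its 5-Harborth constant is 4. The lower
  bound \<open>(p - r) / k + k\<close> would be 5 here, although \<open>3 > 17/6\<close>; hence the theorem has to
  exclude \<open>k = 5\<close>, \<open>p = 3\<close>.\<close>

lemma k_harborth_5_3: "k_harborth 5 (integer_mod_group 3) = 4"
proof -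
  have carr: "carrier (integer_mod_group 3) = {0..<3::int}"
    by (simp add: carrier_integer_mod_group)
  have le: "card S \<le> 3" if "S \<subseteq> {0..<3::int}" for S
    using card_mono[OF _ that] by simp
  show ?thesis
    unfolding k_harborth_def carr
  proof (rule Least_equality)
    show "0 < (4::nat) \<and> (\<forall>S. S \<subseteq> {0..<3::int} \<and> 4 \<le> card S \<longrightarrow>
        (\<exists>T. T \<subseteq> S \<and> card T = 5 \<and>
          finprod (integer_mod_group 3) (\<lambda>x. x) T = \<one>\<^bsub>integer_mod_group 3\<^esub>))"
    proof (intro conjI allI impI)
      fix S :: "int set"
      assume S: "S \<subseteq> {0..<3} \<and> 4 \<le> card S"
      then have "card S \<le> 3" using le by blast
      with S have False by linarith
      then show "\<exists>T. T \<subseteq> S \<and> card T = 5 \<and>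
          finprod (integer_mod_group 3) (\<lambda>x. x) T = \<one>\<^bsub>integer_mod_group 3\<^esub>" ..
    qed simp
  next
    fix t :: nat
    assume t: "0 < t \<and> (\<forall>S. S \<subseteq> {0..<3::int} \<and> t \<le> card S \<longrightarrow>
        (\<exists>T. T \<subseteq> S \<and> card T = 5 \<and>
          finprod (integer_mod_group 3) (\<lambda>x. x) T = \<one>\<^bsub>integer_mod_group 3\<^esub>))"
    show "4 \<le> t"
    proof (rule ccontr)
      assume "\<not> 4 \<le> t"
      then have "t \<le> card {0..<3::int}" by simp
      with t obtain T where "T \<subseteq> {0..<3::int}" "card T = 5" by blast
      with le[of T] show False by simp
    qed
  qed
qed

end

theory Submission
  imports Defs "Jordan_Normal_Form.Determinant" "HOL-Number_Theory.Residues"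
begin

text \<open>The hypotheses on \<open>p\<close> only serve to force \<open>k < p\<close> (apart from \<open>k = 3\<close>, \<open>p = 2\<close>). For
  \<open>k < p\<close> the constant is \<open>n + 1\<close>, where \<open>n\<close> is the largest size with \<open>k * (n - k) + 1 < p\<close>.

  An interval of \<open>n\<close> residues has \<open>k * (n - k) + 1\<close> distinct \<open>k\<close>-subset sums, and a translation keeps
  them off zero. Conversely, the Dias da Silva--Hamidoune theorem gives a zero \<open>k\<close>-subset sum as soon
  as \<open>p \<le> k * (n - k) + 1\<close>. This is proved by the polynomial method of Alon, Nathanson and Ruzsa:
  without a zero sum, \<open>(1 - (x\<^sub>0 + \<dots> + x\<^sub>k\<^sub>-\<^sub>1)\<^bsup>p-1\<^esup>) * V(x)\<close>, with \<open>V\<close> the Vandermonde determinant, would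
  vanish on \<open>A\<^sup>k\<close> modulo \<open>p\<close>, but its coefficient at \<open>\<Prod> x\<^sub>i\<^bsup>c\<^sub>i\<^esup>\<close> is
  \<open>- (p-1)! / (\<Prod> c\<^sub>i!) * \<Prod>\<^bsub>l<i\<^esub> (c\<^sub>i - c\<^sub>l)\<close>, which is nonzero
  modulo \<open>p\<close> for distinct \<open>c\<^sub>i < card A\<close> with the right sum.

  Multivariate polynomials are avoided by integrating against a product of weights \<open>w\<^sub>i\<close> on \<open>A\<close> whose
  moments of order \<open>d \<le> c\<^sub>i\<close> are 0 for \<open>d < c\<^sub>i\<close> and 1 for \<open>d = c\<^sub>i\<close>; this functional picks out
  the coefficient.\<close>

section \<open>Weights with prescribed moments modulo p\<close>

text \<open>If \<open>u\<close> serves \<open>B'\<close>, the weights \<open>u b / (b - b1)\<close>,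
  completed by a weight at \<open>b1\<close> that makes the total zero, have moments S with S(d+1) -
  b1 * S(d) equal to the d-th moment of \<open>u\<close>. Starting from S(0) = 0, this keeps the
  moments zero up to order j and makes the next one 1. Modulo p these are the weights of a divided
  difference.\<close>

lemma moment_weights_exact:
  fixes B :: "int set"
  assumes "prime p" "finite B" "card B = Suc j"
    and "\<And>a b. a \<in> B \<Longrightarrow> b \<in> B \<Longrightarrow> a \<noteq> b \<Longrightarrow> \<not> int p dvd a - b"
  shows "\<exists>w. \<forall>d\<le>j. [(\<Sum>b\<in>B. w b * b ^ d) = (if d = j then 1 else 0)] (mod int p)"
  using assms(2-)
proof (induction j arbitrary: B)
  case 0
  then obtain b where "B = {b}" by (auto simp: card_Suc_eq)
  then show ?case by (intro exI[of _ "\<lambda>_. 1"]) auto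
next
  case (Suc j)
  then obtain b1 B' where B: "B = insert b1 B'" "b1 \<notin> B'" "card B' = Suc j" "finite B'"
    by (metis card_Suc_eq finite_insert)
  obtain u where u: "\<And>d. d \<le> j \<Longrightarrow> [(\<Sum>b\<in>B'. u b * b ^ d) = (if d = j then 1 else 0)] (mod int p)"
    using Suc.IH[OF B(4,3)] Suc.prems(3) B(1) by blast
  have "\<exists>v. [(b - b1) * v = 1] (mod int p)" if "b \<in> B'" for b
  proof -
    have "\<not> int p dvd b - b1" using Suc.prems(3)[of b b1] that B by auto
    then have "coprime (b - b1) (int p)"
      using \<open>prime p\<close> by (simp add: coprime_commute prime_imp_coprime)
    then show ?thesis by (rule cong_solve_coprime_int)
  qed
  then obtain v where v: "\<And>b. b \<in> B' \<Longrightarrow> [(b - b1) * v b = 1] (mod int p)" by metis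
  define w where "w = (\<lambda>b. if b = b1 then - (\<Sum>b\<in>B'. u b * v b) else u b * v b)"
  define S where "S = (\<lambda>d. \<Sum>b\<in>B. w b * b ^ d)"
  have wB': "(\<Sum>b\<in>B'. w b * f b) = (\<Sum>b\<in>B'. u b * v b * f b)" for f
    by (rule sum.cong) (use B(2) in \<open>auto simp: w_def\<close>)
  have S0: "S 0 = 0"
    using B wB'[of "\<lambda>_. 1"] by (simp add: S_def) (simp add: w_def)
  have rec: "[S (Suc d) - b1 * S d = (if d = j then 1 else 0)] (mod int p)" if "d \<le> j" for d
  proof -
    have "S (Suc d) - b1 * S d = (\<Sum>b\<in>B. w b * ((b - b1) * b ^ d))"
      by (simp add: S_def sum_distrib_left sum_subtractf[symmetric] algebra_simps)
    also have "\<dots> = (\<Sum>b\<in>B'. w b * ((b - b1) * b ^ d))" using B by simp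
    also have "\<dots> = (\<Sum>b\<in>B'. u b * v b * ((b - b1) * b ^ d))" by (rule wB')
    also have "\<dots> = (\<Sum>b\<in>B'. ((b - b1) * v b) * (u b * b ^ d))" by (simp add: ac_simps)
    also have "[\<dots> = (\<Sum>b\<in>B'. 1 * (u b * b ^ d))] (mod int p)"
      by (intro cong_sum cong_mult v cong_refl)
    finally show ?thesis using u[OF that] by (metis (no_types, lifting) cong_trans mult_1 sum.cong)
  qed
  have step: "[S (Suc d) = (if d = j then 1 else 0)] (mod int p)" if "d \<le> j" "[S d = 0] (mod int p)" for d
  proof -
    have "[S (Suc d) - b1 * S d + b1 * S d = (if d = j then 1 else 0) + b1 * 0] (mod int p)"
      by (intro cong_add cong_mult rec that cong_refl)
    then show ?thesis by simp
  qed
  have "d \<le> j \<Longrightarrow> [S d = 0] (mod int p)" for d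
  proof (induction d)
    case (Suc d)
    then show ?case using step[of d] by simp
  qed (simp add: S0)
  then have "[S d = (if d = Suc j then 1 else 0)] (mod int p)" if "d \<le> Suc j" for d
    using that step[of j] by (cases "d = Suc j") auto
  then show ?case unfolding S_def by blast
qed

lemma moment_weights:
  fixes A :: "int set"
  assumes "prime p" "finite A" "j < card A"
    and "\<And>a b. a \<in> A \<Longrightarrow> b \<in> A \<Longrightarrow> a \<noteq> b \<Longrightarrow> \<not> int p dvd a - b"
  shows "\<exists>w. \<forall>d\<le>j. [(\<Sum>a\<in>A. w a * a ^ d) = (if d = j then 1 else 0)] (mod int p)"
proof -
  obtain B where B: "B \<subseteq> A" "card B = Suc j"
    using assms(3) by (meson Suc_leI obtain_subset_with_card_n)
  then have "finite B" using assms(2) finite_subset by blast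
  then obtain w where w: "\<And>d. d \<le> j \<Longrightarrow> [(\<Sum>b\<in>B. w b * b ^ d) = (if d = j then 1 else 0)] (mod int p)"
    using moment_weights_exact[OF assms(1) _ B(2)] B(1) assms(4) by blast
  have "(\<Sum>a\<in>A. (if a \<in> B then w a else 0) * a ^ d) = (\<Sum>b\<in>B. w b * b ^ d)" for d
    by (rule sum.mono_neutral_cong_right) (use assms(2) B(1) in auto)
  then show ?thesis using w by (intro exI[of _ "\<lambda>a. if a \<in> B then w a else 0"]) simp
qed

section \<open>Coefficient extraction by weighted sums\<close>

text \<open>With integer factors this is the value at c of a monic polynomial of degree d, as
  \<open>det_falling\<close> uses, and \<open>falling_Suc\<close> holds also beyond d = c.\<close>

definition falling :: "nat \<Rightarrow> nat \<Rightarrow> int" where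
  "falling c d = (\<Prod>l<d. int c - int l)"

lemma falling_Suc: "falling c (Suc d) = falling c d * (int c - int d)"
  by (simp add: falling_def)

lemma falling_eq_0: "c < d \<Longrightarrow> falling c d = 0"
  by (auto simp: falling_def)

lemma falling_self: "falling c c = fact c"
proof -
  have "falling c c = (\<Prod>l<c. int (c - l))"
    unfolding falling_def by (rule prod.cong) auto
  also have "\<dots> = fact c" by (simp add: fact_prod_rev lessThan_atLeast0)
  finally show ?thesis .
qed

lemma weighted_sum_monomial:
  fixes A :: "int set" and w :: "nat \<Rightarrow> int \<Rightarrow> int"
  assumes "finite A"
  shows "(\<Sum>x\<in>PiE {0..<k} (\<lambda>_. A). (\<Prod>i=0..<k. w i (x i)) * (\<Prod>i=0..<k. x i ^ d i))
    = (\<Prod>i=0..<k. \<Sum>a\<in>A. w i a * a ^ d i)"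
  using assms by (simp add: prod_sum_PiE prod.distrib)

text \<open>The sum factors into moments, and the i-th one has order below \<open>c i\<close>, so it
  is divisible by q. The other factors may be anything, including moments of uncontrolled
  order.\<close>

lemma weighted_sum_monomial_cong_0:
  fixes A :: "int set" and k :: nat and c d :: "nat \<Rightarrow> nat" and w :: "nat \<Rightarrow> int \<Rightarrow> int"
  assumes "finite A"
    and W: "\<And>i d. i < k \<Longrightarrow> d \<le> c i \<Longrightarrow> [(\<Sum>a\<in>A. w i a * a ^ d) = (if d = c i then 1 else 0)] (mod q)"
    and "i < k" "d i < c i"
  shows "[(\<Sum>x\<in>PiE {0..<k} (\<lambda>_. A). (\<Prod>i=0..<k. w i (x i)) * (\<Prod>i=0..<k. x i ^ d i)) = 0] (mod q)"
proof -
  have "q dvd (\<Sum>a\<in>A. w i a * a ^ d i)" using W[OF assms(3), of "d i"] assms(4) by (simp add: cong_0_iff)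
  also have "\<dots> dvd (\<Prod>i=0..<k. \<Sum>a\<in>A. w i a * a ^ d i)"
    using assms(3) by (intro dvd_prodI) auto
  finally show ?thesis by (simp add: weighted_sum_monomial[OF assms(1)] cong_0_iff)
qed

text \<open>Stated with falling factorials instead of the multinomial coefficient
  \<open>M! / \<Prod> (c\<^sub>i - d\<^sub>i)!\<close>, so that nothing has to be inverted and the case \<open>d\<^sub>i > c\<^sub>i\<close> needs no
  separate treatment.\<close>

lemma weighted_sum_power_monomial:
  fixes A :: "int set" and k :: nat and c d :: "nat \<Rightarrow> nat" and w :: "nat \<Rightarrow> int \<Rightarrow> int"
  assumes "finite A"
    and W: "\<And>i d. i < k \<Longrightarrow> d \<le> c i \<Longrightarrow> [(\<Sum>a\<in>A. w i a * a ^ d) = (if d = c i then 1 else 0)] (mod q)"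
    and "(\<Sum>i=0..<k. d i) + M = (\<Sum>i=0..<k. c i)"
  shows "[(\<Prod>i=0..<k. fact (c i)) * (\<Sum>x\<in>PiE {0..<k} (\<lambda>_. A). (\<Prod>i=0..<k. w i (x i)) *
      ((\<Sum>i=0..<k. x i) ^ M * (\<Prod>i=0..<k. x i ^ d i)))
    = fact M * (\<Prod>i=0..<k. falling (c i) (d i))] (mod q)"
  using assms(3)
proof (induction M arbitrary: d)
  case 0
  show ?case
  \<comment> \<open>For M = 0 the exponent sums agree, so if d differs from c it is smaller at one
    index, which kills the left side, and larger at another, which kills the right side.\<close>
  proof (cases "\<forall>i<k. d i = c i")
    case True
    have "[(\<Prod>i=0..<k. fact (c i)) * (\<Prod>i=0..<k. \<Sum>a\<in>A. w i a * a ^ d i) =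
       (\<Prod>i=0..<k. fact (c i)) * (\<Prod>i=0..<k. 1)] (mod q)"
      by (intro cong_mult cong_prod cong_refl) (use W True in force)
    then show ?thesis using True by (simp add: weighted_sum_monomial[OF assms(1)] falling_self)
  next
    case False
    from False obtain j where j: "j < k" "d j \<noteq> c j" by blast
    have low: "\<exists>i<k. d i < c i"
    proof (rule ccontr)
      assume "\<not> ?thesis"
      then have le: "c i \<le> d i" if "i < k" for i using that by (meson not_less)
      have "(\<Sum>i=0..<k. c i) < (\<Sum>i=0..<k. d i)"
        by (rule sum_strict_mono_ex1)
          (use j le in \<open>auto intro!: bexI[of _ j] le_neq_implies_less\<close>)
      with 0 show False by simp
    qed
    have "\<exists>i<k. c i < d i"
    proof (rule ccontr)
      assume "\<not> ?thesis"
      then have le: "d i \<le> c i" if "i < k" for i using that by (meson not_less)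
      have "(\<Sum>i=0..<k. d i) < (\<Sum>i=0..<k. c i)"
        by (rule sum_strict_mono_ex1)
          (use j le in \<open>auto intro!: bexI[of _ j] le_neq_implies_less\<close>)
      with 0 show False by simp
    qed
    then have fall: "(\<Prod>i=0..<k. falling (c i) (d i)) = 0"
      by (auto intro!: prod_zero falling_eq_0)
    from low obtain i where i: "i < k" "d i < c i" by blast
    have "[(\<Sum>x\<in>PiE {0..<k} (\<lambda>_. A). (\<Prod>i=0..<k. w i (x i)) * (\<Prod>i=0..<k. x i ^ d i)) = 0] (mod q)"
      by (rule weighted_sum_monomial_cong_0[where c = c and d = d, OF assms(1) _ i]) (rule W)
    then show ?thesis by (simp add: fall cong_0_iff)
  qed
next
  case (Suc M)
  let ?W = "\<lambda>x. \<Prod>i=0..<k. w i (x i)"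
  let ?P = "\<Prod>i=0..<k. fact (c i) :: int"
  \<comment> \<open>One factor of the power is multiplied out. Its summand \<open>x j\<close> raises
    the exponent \<open>d j\<close> by one, which multiplies the product of falling factorials by
    \<open>c j - d j\<close>; these differences add up to \<open>Suc M\<close>, turning
    \<open>fact M\<close> into \<open>fact (Suc M)\<close>.\<close>
  let ?e = "\<lambda>j. d(j := Suc (d j))"
  have mono: "(\<Prod>i=0..<k. x i ^ ?e j i) = x j * (\<Prod>i=0..<k. x i ^ d i)" if "j < k" for j and x :: "nat \<Rightarrow> int"
    using that by (subst (1 2) prod.remove[of _ j]) (auto intro!: prod.cong)
  have fall: "(\<Prod>i=0..<k. falling (c i) (?e j i)) = (int (c j) - int (d j)) * (\<Prod>i=0..<k. falling (c i) (d i))"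
    if "j < k" for j
    using that by (subst (1 2) prod.remove[of _ j]) (auto intro!: prod.cong simp: falling_Suc)
  have sume: "(\<Sum>i=0..<k. ?e j i) = Suc (\<Sum>i=0..<k. d i)" if "j < k" for j
    using that by (subst (1 2) sum.remove[of _ j]) (auto intro!: sum.cong)
  have pow: "(\<Sum>i=0..<k. x i) ^ Suc M * (\<Prod>i=0..<k. x i ^ d i) =
      (\<Sum>j=0..<k. (\<Sum>i=0..<k. x i) ^ M * (\<Prod>i=0..<k. x i ^ ?e j i))" for x :: "nat \<Rightarrow> int"
  proof -
    have "(\<Sum>j=0..<k. (\<Sum>i=0..<k. x i) ^ M * (\<Prod>i=0..<k. x i ^ ?e j i)) =
       (\<Sum>j=0..<k. x j * ((\<Sum>i=0..<k. x i) ^ M * (\<Prod>i=0..<k. x i ^ d i)))"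
      by (intro sum.cong refl, subst mono) auto
    then show ?thesis by (simp add: sum_distrib_right mult.assoc)
  qed
  have expand: "?P * (\<Sum>x\<in>PiE {0..<k} (\<lambda>_. A). ?W x * ((\<Sum>i=0..<k. x i) ^ Suc M * (\<Prod>i=0..<k. x i ^ d i)))
      = (\<Sum>j=0..<k. ?P * (\<Sum>x\<in>PiE {0..<k} (\<lambda>_. A). ?W x * ((\<Sum>i=0..<k. x i) ^ M * (\<Prod>i=0..<k. x i ^ ?e j i))))"
    unfolding pow sum_distrib_left by (rule sum.swap)
  have congr: "[(\<Sum>j=0..<k. ?P * (\<Sum>x\<in>PiE {0..<k} (\<lambda>_. A). ?W x * ((\<Sum>i=0..<k. x i) ^ M * (\<Prod>i=0..<k. x i ^ ?e j i))))
      = (\<Sum>j=0..<k. fact M * (\<Prod>i=0..<k. falling (c i) (?e j i)))] (mod q)"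
  proof (rule cong_sum)
    fix j assume "j \<in> {0..<k}"
    then have "(\<Sum>i=0..<k. ?e j i) + M = (\<Sum>i=0..<k. c i)" using sume[of j] Suc.prems by auto
    then show "[?P * (\<Sum>x\<in>PiE {0..<k} (\<lambda>_. A). ?W x * ((\<Sum>i=0..<k. x i) ^ M * (\<Prod>i=0..<k. x i ^ ?e j i)))
       = fact M * (\<Prod>i=0..<k. falling (c i) (?e j i))] (mod q)"
      by (rule Suc.IH)
  qed
  have "(\<Sum>j=0..<k. fact M * (\<Prod>i=0..<k. falling (c i) (?e j i))) =
      (\<Sum>j=0..<k. (int (c j) - int (d j)) * (fact M * (\<Prod>i=0..<k. falling (c i) (d i))))"
    by (intro sum.cong refl, subst fall) auto
  also have "\<dots> = (int (\<Sum>j=0..<k. c j) - int (\<Sum>j=0..<k. d j)) * (fact M * (\<Prod>i=0..<k. falling (c i) (d i)))"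
    by (simp add: sum_distrib_right[symmetric] sum_subtractf)
  also have "\<dots> = fact (Suc M) * (\<Prod>i=0..<k. falling (c i) (d i))"
    unfolding Suc.prems[symmetric] by (simp add: algebra_simps)
  finally have total: "(\<Sum>j=0..<k. fact M * (\<Prod>i=0..<k. falling (c i) (?e j i))) =
      fact (Suc M) * (\<Prod>i=0..<k. falling (c i) (d i))" .
  show ?case unfolding expand total[symmetric] by (rule congr)
qed

section \<open>Vandermonde determinants in monic bases\<close>

text \<open>The coefficients of the \<open>f j\<close> form an upper triangular matrix with ones on
  the diagonal, and multiplying the Vandermonde matrix by it on the right changes the basis.\<close>

lemma det_monic_eq_det_powers:
  fixes f :: "nat \<Rightarrow> int poly"
  assumes "\<And>j. degree (f j) = j" "\<And>j. Polynomial.coeff (f j) j = 1"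
  shows "det (mat k k (\<lambda>(i, j). poly (f j) (y i))) = det (mat k k (\<lambda>(i, j). y i ^ j))"
proof -
  let ?V = "mat k k (\<lambda>(i, j). y i ^ j)" and ?C = "mat k k (\<lambda>(l, j). Polynomial.coeff (f j) l)"
  have "poly (f j) z = (\<Sum>l=0..<k. z ^ l * Polynomial.coeff (f j) l)" if "j < k" for j z
  proof -
    have "poly (f j) z = (\<Sum>l\<le>j. Polynomial.coeff (f j) l * z ^ l)" by (simp add: poly_altdef assms)
    also have "\<dots> = (\<Sum>l=0..<k. z ^ l * Polynomial.coeff (f j) l)"
      by (rule sum.mono_neutral_cong_left)
        (use that assms(1) in \<open>auto simp: mult.commute coeff_eq_0\<close>)
    finally show ?thesis .
  qed
  then have "mat k k (\<lambda>(i, j). poly (f j) (y i)) = ?V * ?C"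
    by (intro eq_matI) (auto simp: scalar_prod_def)
  also have "det \<dots> = det ?V * det ?C" by (rule det_mult) auto
  also have "det ?C = prod_list (diag_mat ?C)"
    by (rule det_upper_triangular[where n = k]) (use assms(1) in \<open>auto simp: coeff_eq_0\<close>)
  also have "\<dots> = (\<Prod>i=0..<k. 1)"
    unfolding prod_list_diag_prod using assms by (intro prod.cong) auto
  finally show ?thesis by simp
qed

text \<open>Any two monic bases have the same determinant; in the Newton basis with nodes \<open>c\<^sub>l\<close> the matrix
  is triangular.\<close>

lemma det_falling:
  "det (mat k k (\<lambda>(i, j). falling (c i) j)) = (\<Prod>i=0..<k. \<Prod>l<i. int (c i) - int (c l))"
proof -
  define L where "L a j = (\<Prod>l<j. [:- a l, 1:])" for a :: "nat \<Rightarrow> int" and j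
  have deg: "degree (L a j) = j" for a j
    unfolding L_def by (subst degree_prod_sum_eq) auto
  have lead: "Polynomial.coeff (L a j) j = 1" for a j
  proof -
    have "lead_coeff (L a j) = 1"
      unfolding L_def by (simp only: lead_coeff_prod) auto
    then show ?thesis by (simp add: deg)
  qed
  have pL: "poly (L a j) z = (\<Prod>l<j. z - a l)" for a j z
    by (simp add: L_def poly_prod)
  let ?N = "mat k k (\<lambda>(i, j). poly (L (\<lambda>l. int (c l)) j) (int (c i)))"
  \<comment> \<open>Falling factorials are the Newton basis with nodes 0, 1, 2, and so on. With
    nodes c, the entry in row i and column j > i contains the factor
    \<open>c i - c i\<close>.\<close>
  have "det (mat k k (\<lambda>(i, j). falling (c i) j)) =
      det (mat k k (\<lambda>(i, j). poly (L int j) (int (c i))))"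
    by (simp add: falling_def pL)
  also have "\<dots> = det ?N" 
    by (simp only: det_monic_eq_det_powers[where f = "L _", OF deg lead])
  also have "\<dots> = prod_list (diag_mat ?N)"
    by (rule det_lower_triangular[where n = k]) (auto simp: pL)
  also have "\<dots> = (\<Prod>i=0..<k. \<Prod>l<i. int (c i) - int (c l))"
    unfolding prod_list_diag_prod by (rule prod.cong) (auto simp: pL)
  finally show ?thesis .
qed

section \<open>The Dias da Silva--Hamidoune bound\<close>

text \<open>The tuple 0, ..., k-1 is raised by \<open>M div k\<close> everywhere and by one more in
  its last \<open>M mod k\<close> entries, which keeps it strictly increasing. If that remainder is
  positive, the quotient is below n - k, so there is room for the extra one.\<close>

lemma strict_mono_tuple_with_sum:
  fixes k n M :: nat
  assumes "0 < k" "k \<le> n" "M \<le> k * (n - k)"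
  shows "\<exists>c. (\<forall>i<k. c i < n) \<and> (\<forall>l i. l < i \<longrightarrow> i < k \<longrightarrow> c l < c i) \<and>
    (\<Sum>i=0..<k. c i) = (\<Sum>i=0..<k. i) + M"
proof -
  define q s where "q = M div k" and "s = M mod k"
  have M: "M = k * q + s" and s: "s < k" using assms(1) by (simp_all add: q_def s_def)
  define c where "c = (\<lambda>i. i + q + (if k - s \<le> i then 1 else 0))"
  have q: "q \<le> n - k" using assms(3) assms(1) M
    by (metis div_le_mono nonzero_mult_div_cancel_left not_gr_zero q_def)
  have bound: "q + (if s = 0 then 0 else 1) \<le> n - k"
  proof (cases "s = 0")
    case False
    then have "k * q < k * (n - k)" using assms(3) M by linarith
    then show ?thesis by simp
  qed (use q in simp)
  have "c i < n" if "i < k" for i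
    using that bound assms(2) by (auto simp: c_def split: if_splits)
  moreover have "c l < c i" if "l < i" for l i
    using that by (auto simp: c_def)
  moreover have "(\<Sum>i=0..<k. c i) = (\<Sum>i=0..<k. i) + M"
  proof -
    have "(\<Sum>i=0..<k. if k - s \<le> i then 1 else 0) = (\<Sum>i\<in>{k-s..<k}. 1::nat)"
      by (rule sum.mono_neutral_cong_right) auto
    then show ?thesis using s by (simp add: c_def sum.distrib M)
  qed
  ultimately show ?thesis by blast
qed

theorem dias_da_silva_hamidoune_zero:
  fixes A :: "int set"
  assumes p: "prime p" and A: "A \<subseteq> {0..<int p}"
    and k: "0 < k" "k \<le> card A" "p - 1 \<le> k * (card A - k)"
  shows "\<exists>T\<subseteq>A. card T = k \<and> int p dvd \<Sum>T"
proof (rule ccontr)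
  assume no_T: "\<not> ?thesis"
  have fin: "finite A" using A finite_subset by blast
  have cardA: "card A \<le> p" using card_mono[OF _ A] by simp
  have p1: "1 < p" using p prime_gt_1_nat by blast
  have dist: "\<not> int p dvd a - b" if "a \<in> A" "b \<in> A" "a \<noteq> b" for a b
  proof -
    have "\<bar>a - b\<bar> < int p" using subsetD[OF A that(1)] subsetD[OF A that(2)] by auto
    then show ?thesis using that(3) dvd_imp_le_int[of "a - b" "int p"] by auto
  qed
  \<comment> \<open>The target monomial has the degree of \<open>S x ^ (p - 1) * V x\<close>; the
    bound on p - 1 is exactly the room for such distinct exponents, and \<open>c i < card A\<close>
    lets the weights exist.\<close>
  obtain c where c: "\<And>i. i < k \<Longrightarrow> c i < card A" "\<And>l i. l < i \<Longrightarrow> i < k \<Longrightarrow> c l < c i"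
    and sum_c: "(\<Sum>i=0..<k. c i) = (\<Sum>i=0..<k. i) + (p - 1)"
    using strict_mono_tuple_with_sum[OF k] by blast
  have "\<forall>i. \<exists>w. i < k \<longrightarrow> (\<forall>d\<le>c i. [(\<Sum>a\<in>A. w a * a ^ d) = (if d = c i then 1 else 0)] (mod int p))"
    using moment_weights[OF p fin c(1) dist] by blast
  then obtain w where W: "\<And>i d. i < k \<Longrightarrow> d \<le> c i \<Longrightarrow>
      [(\<Sum>a\<in>A. w i a * a ^ d) = (if d = c i then 1 else 0)] (mod int p)" by metis
  define X where "X = PiE {0..<k} (\<lambda>_. A)"
  define \<omega> where "\<omega> x = (\<Prod>i=0..<k. w i (x i))" for x :: "nat \<Rightarrow> int"
  define V where "V x = det (mat k k (\<lambda>(i, j). x i ^ j))" for x :: "nat \<Rightarrow> int"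
  define S where "S x = (\<Sum>i=0..<k. x i)" for x :: "nat \<Rightarrow> int"
  let ?P = "{\<sigma>. \<sigma> permutes {0..<k}}"
  have permutes_bound: "\<sigma> i < k" if "\<sigma> permutes {0..<k}" "i < k" for \<sigma> i
    using permutes_in_image[OF that(1), of i] that(2) by simp
  have leibniz: "det (mat k k (\<lambda>(i, j). g i j)) = (\<Sum>\<sigma>\<in>?P. signof \<sigma> * (\<Prod>i=0..<k. g i (\<sigma> i)))"
    for g :: "nat \<Rightarrow> nat \<Rightarrow> int"
    by (subst det_def'[where n = k]) (auto intro!: sum.cong prod.cong simp: permutes_bound)
  have sum_perm: "(\<Sum>i=0..<k. \<sigma> i) = (\<Sum>i=0..<k. i)" if "\<sigma> \<in> ?P" for \<sigma> :: "nat \<Rightarrow> nat"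
    using that sum.permute[of \<sigma> "{0..<k}" id] by (simp add: o_def)

  have V0: "V x = 0" if not_inj: "\<not> inj_on x {0..<k}" for x
  proof -
    obtain i j where "i < k" "j < k" "i \<noteq> j" "x i = x j" 
      using not_inj by (auto simp: inj_on_def)
    then show ?thesis unfolding V_def by (intro det_identical_rows[of _ k i j]) (auto intro: eq_vecI)
  qed
  \<comment> \<open>A tuple with a repetition has V = 0. Otherwise its entries form a k-subset of A,
    whose sum is nonzero modulo p by assumption, and Fermat's theorem makes the power 1.\<close>
  have term0: "[\<omega> x * (S x ^ (p - 1) * V x) = \<omega> x * V x] (mod int p)" if "x \<in> X" for x
  proof (cases "inj_on x {0..<k}")
    case True
    have xA: "x ` {0..<k} \<subseteq> A" using that by (auto simp: X_def)
    moreover have "card (x ` {0..<k}) = k" using True by (simp add: card_image)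
    ultimately have "\<not> int p dvd \<Sum>(x ` {0..<k})" using no_T by blast
    then have ndvd: "\<not> int p dvd S x" by (simp add: S_def sum.reindex[OF True])
    have "0 \<le> S x" unfolding S_def using xA A by (intro sum_nonneg) force
    then have S: "S x = int (nat (S x))" by simp
    with ndvd have "\<not> p dvd nat (S x)" by (metis int_dvd_int_iff)
    from fermat_theorem[OF p this] have "[int (nat (S x) ^ (p - 1)) = int 1] (mod int p)"
      by (simp only: cong_int_iff)
    then have "[S x ^ (p - 1) = 1] (mod int p)" using S by (metis of_nat_1 of_nat_power)
    then have "[\<omega> x * (S x ^ (p - 1) * V x) = \<omega> x * (1 * V x)] (mod int p)"
      by (intro cong_mult cong_refl)
    then show ?thesis by simp
  qed (simp add: V0)

  \<comment> \<open>V alone has degree p - 1 less than the target monomial, so every Leibniz term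
    has some exponent below \<open>c i\<close> and is annihilated.\<close>
  have low: "[(\<Sum>x\<in>X. \<omega> x * V x) = 0] (mod int p)"
  proof -
    have "(\<Sum>x\<in>X. \<omega> x * V x) = (\<Sum>x\<in>X. \<Sum>\<sigma>\<in>?P. signof \<sigma> * (\<omega> x * (\<Prod>i=0..<k. x i ^ \<sigma> i)))"
      by (simp add: V_def leibniz sum_distrib_left ac_simps)
    also have "\<dots> = (\<Sum>\<sigma>\<in>?P. signof \<sigma> * (\<Sum>x\<in>X. \<omega> x * (\<Prod>i=0..<k. x i ^ \<sigma> i)))"
      by (subst sum.swap) (simp add: sum_distrib_left)
    also have "[\<dots> = (\<Sum>\<sigma>\<in>?P. signof \<sigma> * 0)] (mod int p)"
    proof (intro cong_sum cong_mult cong_refl)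
      fix \<sigma> assume \<sigma>: "\<sigma> \<in> ?P"
      have "\<exists>i<k. \<sigma> i < c i"
      proof (rule ccontr)
        assume "\<not> ?thesis"
        then have "(\<Sum>i=0..<k. c i) \<le> (\<Sum>i=0..<k. \<sigma> i)" by (intro sum_mono) auto
        then show False using sum_c sum_perm[OF \<sigma>] p1 by simp
      qed
      then obtain i where i: "i < k" "\<sigma> i < c i" by blast
      show "[(\<Sum>x\<in>X. \<omega> x * (\<Prod>i=0..<k. x i ^ \<sigma> i)) = 0] (mod int p)"
        unfolding X_def \<omega>_def by (rule weighted_sum_monomial_cong_0[where c = c and d = \<sigma>, OF fin _ i]) (rule W)
    qed
    finally show ?thesis by simp
  qed

  let ?F = "\<Prod>i=0..<k. fact (c i) :: int"
  let ?D = "\<Prod>i=0..<k. \<Prod>l<i. int (c i) - int (c l)"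
  have "?F * (\<Sum>x\<in>X. \<omega> x * (S x ^ (p - 1) * V x)) =
      ?F * (\<Sum>x\<in>X. \<Sum>\<sigma>\<in>?P. signof \<sigma> * (\<omega> x * (S x ^ (p - 1) * (\<Prod>i=0..<k. x i ^ \<sigma> i))))"
    by (simp add: V_def leibniz sum_distrib_left ac_simps)
  also have "\<dots> = (\<Sum>\<sigma>\<in>?P. signof \<sigma> * (?F * (\<Sum>x\<in>X. \<omega> x * (S x ^ (p - 1) * (\<Prod>i=0..<k. x i ^ \<sigma> i)))))"
    by (subst sum.swap) (simp add: sum_distrib_left ac_simps)
  finally have expand: "?F * (\<Sum>x\<in>X. \<omega> x * (S x ^ (p - 1) * V x)) = (\<Sum>\<sigma>\<in>?P. signof \<sigma> * (?F * (\<Sum>x\<in>X. \<omega> x * (S x ^ (p - 1) * (\<Prod>i=0..<k. x i ^ \<sigma> i)))))" .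
  \<comment> \<open>Evaluating each Leibniz term of V by \<open>weighted_sum_power_monomial\<close>
    leaves the Leibniz expansion of the determinant of falling factorials.\<close>
  have congr: "[(\<Sum>\<sigma>\<in>?P. signof \<sigma> * (?F * (\<Sum>x\<in>X. \<omega> x * (S x ^ (p - 1) * (\<Prod>i=0..<k. x i ^ \<sigma> i)))))
      = (\<Sum>\<sigma>\<in>?P. signof \<sigma> * (fact (p - 1) * (\<Prod>i=0..<k. falling (c i) (\<sigma> i))))] (mod int p)"
  proof (rule cong_sum, rule cong_mult[OF cong_refl])
    fix \<sigma> assume \<sigma>: "\<sigma> \<in> ?P"
    show "[?F * (\<Sum>x\<in>X. \<omega> x * (S x ^ (p - 1) * (\<Prod>i=0..<k. x i ^ \<sigma> i)))
        = fact (p - 1) * (\<Prod>i=0..<k. falling (c i) (\<sigma> i))] (mod int p)"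
      unfolding X_def \<omega>_def S_def
    proof (rule weighted_sum_power_monomial[OF fin])
      show "[(\<Sum>a\<in>A. w i a * a ^ d) = (if d = c i then 1 else 0)] (mod int p)"
        if "i < k" "d \<le> c i" for i d
        using that by (rule W)
      show "(\<Sum>i=0..<k. \<sigma> i) + (p - 1) = (\<Sum>i=0..<k. c i)"
        by (simp add: sum_c sum_perm[OF \<sigma>])
    qed
  qed
  have "(\<Sum>\<sigma>\<in>?P. signof \<sigma> * (fact (p - 1) * (\<Prod>i=0..<k. falling (c i) (\<sigma> i)))) =
      fact (p - 1) * det (mat k k (\<lambda>(i, j). falling (c i) j))"
    by (simp add: leibniz sum_distrib_left ac_simps)
  also have "\<dots> = fact (p - 1) * ?D" by (simp only: det_falling)
  finally have coefficient: "(\<Sum>\<sigma>\<in>?P. signof \<sigma> * (fact (p - 1) * (\<Prod>i=0..<k. falling (c i) (\<sigma> i)))) =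
      fact (p - 1) * ?D" .
  have high: "[?F * (\<Sum>x\<in>X. \<omega> x * (S x ^ (p - 1) * V x)) = fact (p - 1) * ?D] (mod int p)"
    using congr unfolding expand coefficient .
  have "[(\<Sum>x\<in>X. \<omega> x * (S x ^ (p - 1) * V x)) = 0] (mod int p)"
    using cong_trans[OF cong_sum[OF term0] low] .
  then have "[?F * (\<Sum>x\<in>X. \<omega> x * (S x ^ (p - 1) * V x)) = 0] (mod int p)"
    by (simp add: cong_0_iff)
  from cong_trans[OF cong_sym[OF high] this] have "int p dvd fact (p - 1) * ?D"
    by (simp only: cong_0_iff)
  moreover have prime_int: "prime (int p)" using p by simp
  moreover have "\<not> int p dvd fact (p - 1)"
  proof -
    have "\<not> p dvd fact (p - 1)" using p p1 by (simp add: prime_dvd_fact_iff)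
    then show ?thesis by (metis int_dvd_int_iff of_nat_fact)
  qed
  \<comment> \<open>The exponents are strictly increasing and below \<open>card A\<close>, which is
    at most p, so their differences lie strictly between 0 and p.\<close>
  moreover have "\<not> int p dvd ?D"
  proof
    assume "int p dvd ?D"
    then obtain i l where i: "i < k" and l: "l < i" "int p dvd int (c i) - int (c l)"
      using prime_int by (auto simp: prime_dvd_prod_iff)
    have "0 < int (c i) - int (c l)" "int (c i) - int (c l) < int p"
      using c(2)[OF l(1) i] c(1)[OF i] cardA by auto
    with l(2) show False using zdvd_imp_le by fastforce
  qed
  ultimately show False by (simp add: prime_dvd_mult_iff)
qed

section \<open>Sums in the cyclic group and subset sums of an interval\<close>

lemma finprod_integer_mod_group:
  assumes "0 < p" "T \<subseteq> {0..<int p}"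
  shows "finprod (integer_mod_group p) (\<lambda>x. x) T = \<Sum>T mod int p"
proof -
  interpret comm_group "integer_mod_group p" by simp
  have carr: "carrier (integer_mod_group p) = {0..<int p}"
    using assms(1) by (simp add: carrier_integer_mod_group)
  have "finite T" using assms(2) finite_subset by blast
  then show ?thesis using assms(2)
  proof (induction T)
    case (insert x F)
    then have "finprod (integer_mod_group p) (\<lambda>x. x) (insert x F) = (x + \<Sum>F mod int p) mod int p"
      by (subst finprod_insert) (auto simp: carr)
    then show ?case using insert.hyps by (simp add: mod_add_right_eq)
  qed simp
qed

text \<open>Induction by removing the maximum: among m + 1 distinct naturals it is at least
  m.\<close>

lemma sum_lessThan_card_le:
  fixes I :: "nat set"
  assumes "finite I"
  shows "\<Sum>{..<card I} \<le> \<Sum>I"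
  using assms
proof (induction "card I" arbitrary: I)
  case (Suc m)
  then have ne: "I \<noteq> {}" by auto
  have max: "Max I \<in> I" using Suc.prems ne by (rule Max_in)
  have "I \<subseteq> {..Max I}" using Suc.prems by auto
  from card_mono[OF _ this] have m: "m \<le> Max I" using Suc.hyps(2) by simp
  have cm: "card (I - {Max I}) = m" using Suc.hyps(2) Suc.prems max by simp
  have "\<Sum>{..<m} \<le> \<Sum>(I - {Max I})"
    using Suc.hyps(1)[of "I - {Max I}"] cm Suc.prems by simp
  moreover have "\<Sum>I = Max I + \<Sum>(I - {Max I})" using Suc.prems max by (simp add: sum.remove)
  ultimately show ?case using m by (simp add: Suc.hyps(2)[symmetric])
qed simp

text \<open>Reflecting i to n - 1 - i turns this upper bound into the lower bound
  \<open>sum_lessThan_card_le\<close>.\<close>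

lemma sum_le_sum_lessThan_card:
  fixes I :: "nat set"
  assumes "I \<subseteq> {..<n}"
  shows "\<Sum>I \<le> \<Sum>{..<card I} + card I * (n - card I)"
proof -
  let ?k = "card I"
  have fin: "finite I" using assms finite_subset by blast
  have kn: "?k \<le> n" using card_mono[OF _ assms] by simp
  have inj: "inj_on (\<lambda>i. n - 1 - i) I" 
  proof (rule inj_onI)
    fix i j assume "i \<in> I" "j \<in> I" "n - 1 - i = n - 1 - j"
    moreover from this have "i < n" "j < n" using assms by auto
    ultimately show "i = j" by linarith
  qed
  have "\<Sum>{..<?k} \<le> \<Sum>((\<lambda>i. n - 1 - i) ` I)"
    using sum_lessThan_card_le[of "(\<lambda>i. n - 1 - i) ` I"] fin by (simp only: card_image[OF inj] finite_imageI)
  also have "\<dots> = (\<Sum>i\<in>I. n - 1 - i)" by (simp only: sum.reindex[OF inj] o_def)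
  finally have "\<Sum>I + \<Sum>{..<?k} \<le> (\<Sum>i\<in>I. i + (n - 1 - i))" by (simp add: sum.distrib)
  also have "\<dots> = (\<Sum>i\<in>I. n - 1)" by (rule sum.cong) (use assms in auto)
  finally have *: "\<Sum>I + \<Sum>{..<?k} \<le> ?k * (n - 1)" by simp
  have "2 * \<Sum>{..<m} = m * (m - 1)" for m :: nat
  proof (induction m)
    case (Suc m)
    then show ?case by (cases m) (auto simp: algebra_simps)
  qed simp
  then have "\<Sum>{..<?k} + \<Sum>{..<?k} = ?k * (?k - 1)" by (metis mult_2)
  moreover have "?k * (n - 1) = ?k * (?k - 1) + ?k * (n - ?k)"
    using kn by (cases "?k = 0") (auto simp: add_mult_distrib2[symmetric])
  ultimately show ?thesis using * by linarith
qed

text \<open>An interval of residues has the fewest \<open>k\<close>-subset sums: they form an interval of length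
  \<open>k * (n - k) + 1\<close>, and since \<open>k\<close> is invertible modulo \<open>p\<close> a translation moves it to begin at 1.\<close>

lemma interval_without_zero_subset_sum:
  assumes p: "prime p" and k: "0 < k" "k < p" and n: "n \<le> p" "k * (n - k) + 1 < p"
  shows "\<exists>S\<subseteq>{0..<int p}. card S = n \<and> (\<forall>T\<subseteq>S. card T = k \<longrightarrow> \<not> int p dvd \<Sum>T)"
proof -
  have "\<not> p dvd k" using k by (auto dest: dvd_imp_le)
  with p have "coprime p k" by (rule prime_imp_coprime)
  then have "coprime (int k) (int p)" by (simp add: coprime_commute)
  then obtain v where v: "[int k * v = 1] (mod int p)" using cong_solve_coprime_int by blast
  define \<tau> where "\<tau> = \<Sum>{..<k}"
  \<comment> \<open>The least sum of k distinct indices is \<open>\<tau>\<close>; this a makes the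
    corresponding subset sum \<open>k * a + \<tau>\<close> congruent to 1.\<close>
  define a where "a = v * (1 - int \<tau>)"
  have a: "[int k * a + int \<tau> = 1] (mod int p)"
  proof -
    have "[(int k * v) * (1 - int \<tau>) + int \<tau> = 1 * (1 - int \<tau>) + int \<tau>] (mod int p)"
      by (intro cong_add cong_mult v cong_refl)
    then show ?thesis by (simp add: a_def mult.assoc)
  qed
  define f where "f i = (a + int i) mod int p" for i
  have inj: "inj_on f {..<n}"
  proof (rule inj_onI)
    fix i j assume ij: "i \<in> {..<n}" "j \<in> {..<n}" "f i = f j"
    then have "[a + int i = a + int j] (mod int p)" by (simp add: f_def cong_def)
    then have "[i = j] (mod p)" by (simp add: cong_add_lcancel cong_int_iff)
    then show "i = j" using ij(1,2) n(1) by (auto simp: cong_def)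
  qed
  have p0: "0 < p" using k by simp
  show ?thesis
  proof (intro exI[of _ "f ` {..<n}"] conjI allI impI)
    show "f ` {..<n} \<subseteq> {0..<int p}" using p0 by (auto simp: f_def)
    show "card (f ` {..<n}) = n" using inj by (simp add: card_image)
    fix T assume T: "T \<subseteq> f ` {..<n}" "card T = k"
    then obtain I where I: "I \<subseteq> {..<n}" "T = f ` I" by (auto simp: subset_image_iff)
    have injI: "inj_on f I" using inj I(1) inj_on_subset by blast
    have cI: "card I = k" using T(2) I(2) card_image[OF injI] by simp
    have fin: "finite I" using I(1) finite_subset by blast
    have "\<tau> \<le> \<Sum>I" "\<Sum>I \<le> \<tau> + k * (n - k)"
      using sum_lessThan_card_le[OF fin] sum_le_sum_lessThan_card[OF I(1)] by (simp_all add: cI \<tau>_def)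
    \<comment> \<open>The excess e over the least sum makes the sum of T congruent to 1 + e, which
      lies between 1 and p - 1.\<close>
    then obtain e where e: "\<Sum>I = \<tau> + e" "e \<le> k * (n - k)" by (metis add_le_cancel_left le_Suc_ex)
    have "\<Sum>T = (\<Sum>i\<in>I. (a + int i) mod int p)" 
      using I(2) by (simp add: sum.reindex[OF injI]) (simp add: f_def)
    also have "[\<dots> = (\<Sum>i\<in>I. a + int i)] (mod int p)" by (intro cong_sum) simp
    also have "(\<Sum>i\<in>I. a + int i) = int k * a + int \<tau> + int e"
      using e(1) by (simp add: sum.distrib cI flip: of_nat_sum)
    also have "[\<dots> = 1 + int e] (mod int p)" by (intro cong_add a cong_refl)
    finally have "[\<Sum>T = 1 + int e] (mod int p)" .
    moreover have "\<not> int p dvd 1 + int e"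
    proof
      assume "int p dvd 1 + int e"
      then have "int p \<le> 1 + int e" by (rule zdvd_imp_le) simp
      with e(2) n(2) show False by linarith
    qed
    ultimately show "\<not> int p dvd \<Sum>T" using cong_dvd_iff by (metis cong_sym cong_def dvd_eq_mod_eq_0)
  qed
qed

section \<open>Evaluation of the Harborth constant\<close>

lemma k_harborth_integer_mod_group:
  assumes "0 < p"
  shows "k_harborth k (integer_mod_group p) =
    (LEAST t. 0 < t \<and> (\<forall>S. S \<subseteq> {0..<int p} \<and> t \<le> card S \<longrightarrow>
      (\<exists>T\<subseteq>S. card T = k \<and> int p dvd \<Sum>T)))"
proof -
  have carr: "carrier (integer_mod_group p) = {0..<int p}"
    using assms by (simp add: carrier_integer_mod_group)
  have "(\<exists>T. T \<subseteq> S \<and> card T = k \<and> finprod (integer_mod_group p) (\<lambda>x. x) T = \<one>\<^bsub>integer_mod_group p\<^esub>)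
      \<longleftrightarrow> (\<exists>T\<subseteq>S. card T = k \<and> int p dvd \<Sum>T)" if "S \<subseteq> {0..<int p}" for S
    using that finprod_integer_mod_group[OF assms] by (metis dvd_eq_mod_eq_0 one_integer_mod_group order_trans)
  then show ?thesis unfolding k_harborth_def carr
    by (intro arg_cong[where f = Least] ext conj_cong refl all_cong1 imp_cong) blast+
qed

lemma k_harborth_eqI:
  assumes "0 < p"
    and upper: "\<And>S. S \<subseteq> {0..<int p} \<Longrightarrow> n < card S \<Longrightarrow> \<exists>T\<subseteq>S. card T = k \<and> int p dvd \<Sum>T"
    and lower: "S \<subseteq> {0..<int p}" "card S = n" "\<And>T. T \<subseteq> S \<Longrightarrow> card T = k \<Longrightarrow> \<not> int p dvd \<Sum>T"
  shows "k_harborth k (integer_mod_group p) = n + 1"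
  unfolding k_harborth_integer_mod_group[OF assms(1)]
proof (rule Least_equality)
  show "0 < n + 1 \<and> (\<forall>S. S \<subseteq> {0..<int p} \<and> n + 1 \<le> card S \<longrightarrow>
      (\<exists>T\<subseteq>S. card T = k \<and> int p dvd \<Sum>T))"
    using upper by simp
  fix t assume t: "0 < t \<and> (\<forall>S. S \<subseteq> {0..<int p} \<and> t \<le> card S \<longrightarrow>
      (\<exists>T\<subseteq>S. card T = k \<and> int p dvd \<Sum>T))"
  show "n + 1 \<le> t"
  proof (rule ccontr)
    assume "\<not> n + 1 \<le> t"
    then have "\<exists>T\<subseteq>S. card T = k \<and> int p dvd \<Sum>T" using t lower(1,2) by simp
    then show False using lower(3) by blast
  qed
qed

text \<open>The last two inequalities say that p exceeds the number of k-subset sums of n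
  consecutive integers but not that of n + 1. The interval gives the lower bound, Dias da
  Silva--Hamidoune the upper one.\<close>

lemma k_harborth_prime:
  assumes p: "prime p" and k: "0 < k" "k < p" "k \<le> n" and n: "n \<le> p"
    and "k * (n - k) + 1 < p" "p \<le> k * (n + 1 - k) + 1"
  shows "k_harborth k (integer_mod_group p) = n + 1"
proof -
  have p0: "0 < p" using k by simp
  obtain S where S: "S \<subseteq> {0..<int p}" "card S = n"
    "\<And>T. T \<subseteq> S \<Longrightarrow> card T = k \<Longrightarrow> \<not> int p dvd \<Sum>T"
    using interval_without_zero_subset_sum[OF p k(1,2) n assms(6)] by blast
  show ?thesis
  proof (rule k_harborth_eqI[OF p0 _ S])
    fix S assume S: "S \<subseteq> {0..<int p}" "n < card S"
    have "n + 1 - k \<le> card S - k" using S(2) by simp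
    then have "k * (n + 1 - k) \<le> k * (card S - k)" by (rule mult_le_mono2)
    then have "p - 1 \<le> k * (card S - k)" using assms(7) by linarith
    then show "\<exists>T\<subseteq>S. card T = k \<and> int p dvd \<Sum>T"
      using S k by (intro dias_da_silva_hamidoune_zero[OF p]) auto
  qed
qed

text \<open>No k-subset exists here, so the whole group is a counterexample and the defining
  condition first holds, vacuously, at p + 1. This covers k = 3, p = 2.\<close>

lemma k_harborth_less:
  assumes "0 < p" "p < k"
  shows "k_harborth k (integer_mod_group p) = p + 1"
proof (rule k_harborth_eqI[OF assms(1), where S = "{0..<int p}"])
  have le: "card T \<le> p" if "T \<subseteq> {0..<int p}" for T
    using card_mono[OF _ that] by simp
  show "\<exists>T\<subseteq>S. card T = k \<and> int p dvd \<Sum>T" if "S \<subseteq> {0..<int p}" "p < card S" for S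
    using le[OF that(1)] that(2) by simp
  show "\<not> int p dvd \<Sum>T" if "T \<subseteq> {0..<int p}" "card T = k" for T
    using le[OF that(1)] that(2) assms(2) by simp
qed simp_all

text \<open>For n = q + k the condition \<open>k * (n - k) + 1 < p\<close> reads 1 < r. Thus r = 1
  is the boundary case, in which the largest admissible n drops to q + k - 1.\<close>

lemma k_harborth_prime_remainder:
  assumes p: "prime p" and k: "2 \<le> k" "k < p" and r: "p = k * q + r" "1 \<le> r" "r < k"
  shows "k_harborth k (integer_mod_group p) = q + k + (if r = 1 then 0 else 1)"
proof -
  have q: "1 \<le> q" using k(2) r by (cases q) auto
  then obtain q' where q': "q = Suc q'" by (cases q) auto
  obtain k' where k': "k = Suc (Suc k')" using k(1) by (metis add_2_eq_Suc le_Suc_ex)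
  \<comment> \<open>Since (k - 1) * (q - 1) is nonnegative, q + k is at most k * q + 1.\<close>
  have le: "q + k \<le> p" using r by (simp add: q' k')
  show ?thesis
  proof (cases "r = 1")
    case True
    have "k_harborth k (integer_mod_group p) = (q' + k) + 1"
      
      by (rule k_harborth_prime[OF p]) (use k le q' in simp_all, use r True in simp_all)
    then show ?thesis using True q' by simp
  next
    case False
    have "k_harborth k (integer_mod_group p) = (q + k) + 1"
      
      by (rule k_harborth_prime[OF p]) (use k le in simp_all, use r False in simp_all)
    then show ?thesis using False by simp
  qed
qed

theorem theorem3p11:
  fixes k m p r :: nat
  assumes k: "3 \<le> k"
    and k_even: "even k \<Longrightarrow> k = 2 * m \<and> 2 \<le> m"
    and k_odd: "odd k \<Longrightarrow> k = 2 * m + 1 \<and> 1 \<le> m"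
    and p: "prime p"
    and p_even: "even k \<Longrightarrow> p > m ^ 2"
    and p_odd: "odd k \<Longrightarrow>
      real p > (2 * real m ^ 3 + 5 * real m ^ 2 - 8 * real m - 3) / (2 * (real m + 1))"
    and exception: "\<not> (k = 5 \<and> p = 3)"
    and r: "r \<in> {0..k - 1}" "[p = r] (mod k)"
  shows
    "(even k \<and> r \<in> {1} \<union> {m + 1..k - 1} \<longrightarrow>
        (r = 1 \<longrightarrow> real (k_harborth k (integer_mod_group p)) = (real p - 1) / real k + real k) \<and>
        (r \<noteq> 1 \<longrightarrow> real (k_harborth k (integer_mod_group p)) = (real p - real r) / real k + real k + 1))
     \<and>
     (odd k \<and> r \<in> {1..k - 1} \<longrightarrow>
        (r = 1 \<longrightarrow> real (k_harborth k (integer_mod_group p)) = (real p - 1) / real k + real k) \<and>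
        (r \<noteq> 1 \<longrightarrow> (real p - real r) / real k + real k \<le> real (k_harborth k (integer_mod_group p)) \<and>
                   real (k_harborth k (integer_mod_group p)) \<le> (real p - real r) / real k + real k + 1))"
proof (cases "r = 0")
  case False
  have rk: "r < k" using r(1) k by auto
  define q where "q = p div k"
  have pq: "p = k * q + r"
    using r(2) rk by (metis cong_def mod_less mult_div_mod_eq q_def)
  have p2: "2 \<le> p" using p prime_ge_2_nat by blast
  \<comment> \<open>The case p = k would give r = 0. For p < k the size condition fails when k is
    even or m is at least 3; for m = 1 its bound is negative and for m = 2 it is 17/6, so small
    primes remain to be checked.\<close>
  have small: "k = 3 \<and> p = 2" if "p \<le> k"
  proof -
    have "p \<noteq> k" using pq False rk by (metis cong_def mod_less mod_self r(2))
    with that have "p < k" by simp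
    show ?thesis
    proof (cases "even k")
      case True
      then have "2 * m \<le> m ^ 2" using k_even by (simp add: power2_eq_square)
      then show ?thesis using p_even[OF True] k_even[OF True] \<open>p < k\<close> by simp
    next
      case odd: False
      show ?thesis
      proof (cases "m \<le> 2")
        case True
        then consider "m = 1" | "m = 2" using k_odd[OF odd] by linarith
        then show ?thesis
        proof cases
          case 1
          then show ?thesis using k_odd[OF odd] \<open>p < k\<close> p2 by simp
        next
          case 2
          then have k5: "k = 5" using k_odd[OF odd] by simp
          have "17 / 6 < real p" using p_odd[OF odd] 2 by simp
          then have "p = 3 \<or> p = 4" using \<open>p < k\<close> k5 by linarith
          moreover have "\<not> prime (4::nat)"
            using prime_product[of 2 "2::nat"] by auto
          ultimately show ?thesis using exception k5 p by metis
        qed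
      next
        case False
        define M where "M = real m"
        have M: "3 \<le> M" using False by (simp add: M_def)
        \<comment> \<open>The right side is the numerator of the bound minus 2 * (M + 1) * (2 * M +
          1), divided by M - 3 with remainder 16.\<close>
        have "0 \<le> (M - 3) * (2 * M * M + 7 * M + 7) + 16" using M by simp
        then have "2 * (M + 1) * (2 * M + 1) \<le> 2 * M ^ 3 + 5 * M ^ 2 - 8 * M - 3"
          by (simp add: power2_eq_square power3_eq_cube algebra_simps)
        then have "2 * M + 1 \<le> (2 * M ^ 3 + 5 * M ^ 2 - 8 * M - 3) / (2 * (M + 1))"
          using M by (simp add: pos_le_divide_eq mult.commute)
        also have "\<dots> < real p" using p_odd[OF odd] by (simp add: M_def)
        finally have "real k < real p" using k_odd[OF odd] by (simp add: M_def)
        then show ?thesis using \<open>p < k\<close> by simp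
      qed
    qed
  qed
  have quot: "(real p - real r) / real k = real q" using pq k by simp
  show ?thesis
  proof (cases "p \<le> k")
    case True
    \<comment> \<open>Here q = 0 and the constant 3 is the lower bound in (ii); when k < p and r is
      not 1, the upper bound is attained.\<close>
    then have kp: "k = 3" "p = 2" using small by auto
    then have "r = 2" using r(2) rk by (simp add: cong_def)
    moreover have "k_harborth k (integer_mod_group p) = 3" using k_harborth_less[of p k] kp by simp
    ultimately show ?thesis using kp by simp
  next
    case False
    have "k_harborth k (integer_mod_group p) = q + k + (if r = 1 then 0 else 1)"
      by (rule k_harborth_prime_remainder[OF p]) (use k False pq rk \<open>r \<noteq> 0\<close> in auto)
    then show ?thesis using quot by auto
  qed
\<comment> \<open>For r = 0 neither residue set contains r, so both implications are
  vacuous.\<close>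
qed auto

end
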